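(* Let $n$ be a positive integer and let $\Gamma$ be an unbalanced signed graph of order $n$, and let $r$ be an integer with $4 \le r \le \lfloor n/3 \rfloor + 1$. Let $\Gamma_1 = C_3^- \bullet K_{n-2}$ be the signed graph obtained by taking an all-positive complete graph $K_{n-2}$ and a triangle $C_3^-$ having exactly one negative edge, and identifying one vertex of $K_{n-2}$ with the vertex of $C_3^-$ whose two incident edges in $C_3^-$ are both positive. If $\lambda_1(\Gamma) \ge \lambda_1(\Gamma_1)$, then $\Gamma$ contains a negative cycle of length $r$, unless $\Gamma$ is switching equivalent to $\Gamma_1$.
   Context: A signed graph $\Gamma=(G,\sigma)$ is a simple graph $G$ together with a sign function $\sigma: E(G)\to\{+1,-1\}$. Its adjacency matrix $A(\Gamma)$ has $(u,v)$-entry $\sigma(uv)$ if $uv\in E(G)$ and $0$ otherwise; the index $\lambda_1(\Gamma)$ is the largest eigenvalue of $A(\Gamma)$. The sign of a cycle is the product of the signs of its edges; a cycle is negative (unbalanced) if its sign is $-1$ and positive otherwise. A signed graph is balanced if all its cycles are positive, and unbalanced otherwise. Switching at a vertex set $U$ reverses the signs of all edges with exactly one endpoint in $U$; two signed graphs are switching equivalent if one can be obtained from the other by a switching (possibly composed with an isomorphism). "Contains a negative cycle of length $r$" means it has a subgraph which is a cycle of length $r$ whose sign is negative. *)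

theory Defs
  imports "HOL-Analysis.Analysis"
begin

text \<open>The vertex set of a signed graph is the whole finite type \<open>'v\<close>, so its order is \<open>CARD('v)\<close>.
  An edge is a two-element set of vertices. Values of \<open>esign\<close> outside \<open>edges\<close> are irrelevant,
  and no notion below depends on them.\<close>

record 'v sgraph =
  edges :: "'v set set"
  esign :: "'v set \<Rightarrow> int"

definition signed_graph :: "'v::finite sgraph \<Rightarrow> bool" where
  "signed_graph \<Gamma> \<longleftrightarrow> (\<forall>e\<in>edges \<Gamma>. card e = 2 \<and> (esign \<Gamma> e = 1 \<or> esign \<Gamma> e = -1))"

definition adj_matrix :: "'v::finite sgraph \<Rightarrow> real^'v^'v" where
  "adj_matrix \<Gamma> = (\<chi> u v. if {u, v} \<in> edges \<Gamma> then of_int (esign \<Gamma> {u, v}) else 0)"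

definition eigenvalues :: "real^'v^'v::finite \<Rightarrow> real set" where
  "eigenvalues A = {c. \<exists>x. x \<noteq> 0 \<and> A *v x = c *\<^sub>R x}"

text \<open>The maximum exists because the adjacency matrix of a signed graph is real symmetric: its set
  of real eigenvalues is finite and nonempty.\<close>

definition index :: "'v::finite sgraph \<Rightarrow> real" where
  "index \<Gamma> = Max (eigenvalues (adj_matrix \<Gamma>))"

text \<open>A cycle is given by its vertices in cyclic order; \<open>cyc_edge vs i\<close> joins the \<open>i\<close>-th of them
  to the next one, the last being followed by the first.\<close>

definition cyc_edge :: "'v list \<Rightarrow> nat \<Rightarrow> 'v set" where
  "cyc_edge vs i = {vs ! i, vs ! (Suc i mod length vs)}"

definition is_cycle :: "'v::finite sgraph \<Rightarrow> 'v list \<Rightarrow> bool" where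
  "is_cycle \<Gamma> vs \<longleftrightarrow>
     length vs \<ge> 3 \<and> distinct vs \<and> (\<forall>i<length vs. cyc_edge vs i \<in> edges \<Gamma>)"

definition cycle_sign :: "'v::finite sgraph \<Rightarrow> 'v list \<Rightarrow> int" where
  "cycle_sign \<Gamma> vs = (\<Prod>i<length vs. esign \<Gamma> (cyc_edge vs i))"

definition balanced :: "'v::finite sgraph \<Rightarrow> bool" where
  "balanced \<Gamma> \<longleftrightarrow> (\<forall>vs. is_cycle \<Gamma> vs \<longrightarrow> cycle_sign \<Gamma> vs = 1)"

definition contains_negative_cycle :: "'v::finite sgraph \<Rightarrow> nat \<Rightarrow> bool" where
  "contains_negative_cycle \<Gamma> r \<longleftrightarrow>
     (\<exists>vs. is_cycle \<Gamma> vs \<and> length vs = r \<and> cycle_sign \<Gamma> vs = -1)"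

definition switching :: "'v set \<Rightarrow> 'v::finite sgraph \<Rightarrow> 'v sgraph" where
  "switching U \<Gamma> =
     \<Gamma>\<lparr>esign := (\<lambda>e. if card (e \<inter> U) = 1 then - esign \<Gamma> e else esign \<Gamma> e)\<rparr>"

definition sgraph_iso :: "('v \<Rightarrow> 'w) \<Rightarrow> 'v::finite sgraph \<Rightarrow> 'w::finite sgraph \<Rightarrow> bool" where
  "sgraph_iso f \<Gamma> \<Delta> \<longleftrightarrow>
     bij f \<and> edges \<Delta> = (\<lambda>e. f ` e) ` edges \<Gamma> \<and>
     (\<forall>e\<in>edges \<Gamma>. esign \<Delta> (f ` e) = esign \<Gamma> e)"

definition switching_equivalent :: "'v::finite sgraph \<Rightarrow> 'w::finite sgraph \<Rightarrow> bool" where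
  "switching_equivalent \<Gamma> \<Delta> \<longleftrightarrow> (\<exists>U f. sgraph_iso f (switching U \<Gamma>) \<Delta>)"

text \<open>For distinct \<open>u\<close>, \<open>a\<close>, \<open>b\<close> this is \<open>C\<^sub>3\<^sup>- \<bullet> K\<^bsub>n-2\<^esub>\<close> with \<open>n = CARD('v)\<close>: the complete graph lives on
  the \<open>n - 2\<close> vertices other than \<open>a\<close> and \<open>b\<close>, the triangle is \<open>u a b\<close> with negative edge \<open>a b\<close>,
  and \<open>u\<close> is the identified vertex.\<close>

definition C3neg_bullet_K :: "'v \<Rightarrow> 'v \<Rightarrow> 'v \<Rightarrow> 'v::finite sgraph" where
  "C3neg_bullet_K u a b =
     \<lparr>edges = {e. e \<subseteq> - {a, b} \<and> card e = 2} \<union> {{u, a}, {u, b}, {a, b}},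
      esign = (\<lambda>e. if e = {a, b} then -1 else 1)\<rparr>"

end

theory Submission
  imports Defs
begin

text \<open>
  The index \<open>\<lambda>\<close> of \<open>\<Gamma>\<close> exceeds \<open>n - 3\<close>. Switch \<open>\<Gamma>\<close> so that an eigenvector \<open>x\<close> for \<open>\<lambda>\<close> is nonnegative, and scale
  it to have maximum \<open>1\<close>, attained at a hub \<open>h\<close>. The eigenvalue equation at \<open>h\<close> shows that the positive
  edges join \<open>h\<close> to all other vertices except at most one vertex \<open>c\<close>, and that the deficits \<open>1 - x v\<close>
  sum to less than \<open>2\<close> (to less than \<open>1\<close> over the vertices other than \<open>c\<close>, if \<open>c\<close> exists). As a vertex
  \<open>v\<close> has at least \<open>\<lambda> * x v\<close> positive neighbours, at most two vertices have low positive degree. Since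
  \<open>\<Gamma>\<close> is unbalanced, some edge \<open>p q\<close> is negative after switching. Two disjoint positive paths starting
  at \<open>p\<close> and \<open>q\<close> are grown greedily outside \<open>h\<close> to any total length up to \<open>n/3\<close>, and are then closed to a
  negative cycle through \<open>h\<close>. This can only fail if \<open>h\<close> is the unique positive neighbour of both \<open>p\<close> and
  \<open>q\<close>; then the switched adjacency matrix is dominated entrywise by that of \<open>C\<^sub>3\<^sup>- \<bullet> K\<^bsub>n-2\<^esub>\<close>, and
  comparison with the positive eigenvector of the latter forces equality.
\<close>

section \<open>Spectra of symmetric matrices and of \<open>C\<^sub>3\<^sup>- \<bullet> K\<^bsub>n-2\<^esub>\<close>\<close>

lemma symmetric_matrix_inner:
  fixes A :: "real^'n::finite^'n"
  assumes "transpose A = A"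
  shows "x \<bullet> (A *v y) = (A *v x) \<bullet> y"
  using dot_lmul_matrix[of x A y] vector_transpose_matrix[of x A] assms by simp

text \<open>Eigenvectors for distinct eigenvalues are orthogonal, so choosing one for each
  eigenvalue embeds the spectrum into a pairwise orthogonal set.\<close>

lemma finite_eigenvalues_symmetric:
  fixes A :: "real^'n::finite^'n"
  assumes "transpose A = A"
  shows "finite (eigenvalues A)"
proof -
  define X where "X c = (SOME x. x \<noteq> 0 \<and> A *v x = c *\<^sub>R x)" for c
  have X: "X c \<noteq> 0" "A *v X c = c *\<^sub>R X c" if "c \<in> eigenvalues A" for c
    using that someI_ex[of "\<lambda>x. x \<noteq> 0 \<and> A *v x = c *\<^sub>R x"] by (auto simp: X_def eigenvalues_def)
  have orth: "X c \<bullet> X d = 0" if "c \<in> eigenvalues A" "d \<in> eigenvalues A" "c \<noteq> d" for c d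
  proof -
    have "d * (X c \<bullet> X d) = c * (X c \<bullet> X d)"
      using symmetric_matrix_inner[OF assms, of "X c" "X d"] X that by simp
    with \<open>c \<noteq> d\<close> show ?thesis by simp
  qed
  have "inj_on X (eigenvalues A)"
    using orth X by (metis inj_onI inner_eq_zero_iff)
  moreover have "finite (X ` eigenvalues A)"
    by (rule pairwise_orthogonal_imp_finite) (auto simp: pairwise_def orthogonal_def intro: orth)
  ultimately show ?thesis by (rule finite_imageD[rotated])
qed

text \<open>The quadratic form attains its maximum \<open>c\<close> over the unit sphere at an eigenvector for \<open>c\<close>,
  by the first-order condition.\<close>

lemma eigenvalues_symmetric_nonempty:
  fixes A :: "real^'n::finite^'n"
  assumes "transpose A = A"
  shows "eigenvalues A \<noteq> {}"
proof -
  have "continuous_on (sphere 0 1) (\<lambda>x. x \<bullet> (A *v x))"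
    by (intro continuous_intros linear_continuous_on matrix_vector_mul_bounded_linear)
  moreover have "sphere (0 :: real^'n) 1 \<noteq> {}" by simp
  ultimately have "\<exists>x\<in>sphere 0 1. \<forall>y\<in>sphere 0 1. y \<bullet> (A *v y) \<le> x \<bullet> (A *v x)"
    using continuous_attains_sup[OF compact_sphere] by blast
  then obtain x :: "real^'n" where x: "norm x = 1"
    and max: "\<And>y. norm y = 1 \<Longrightarrow> y \<bullet> (A *v y) \<le> x \<bullet> (A *v x)"
    by auto
  define c where "c = x \<bullet> (A *v x)"
  have le: "y \<bullet> (A *v y) \<le> c * (y \<bullet> y)" for y
  proof (cases "y = 0")
    case False
    define u where "u = y /\<^sub>R norm y"
    have "norm u = 1" "y = norm y *\<^sub>R u" using False by (simp_all add: u_def)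
    have "y \<bullet> (A *v y) = (norm y *\<^sub>R u) \<bullet> (A *v (norm y *\<^sub>R u))"
      using \<open>y = norm y *\<^sub>R u\<close> by simp
    also have "\<dots> = (norm y)\<^sup>2 * (u \<bullet> (A *v u))"
      by (simp add: matrix_vector_mult_scaleR power2_eq_square)
    finally have "y \<bullet> (A *v y) = (norm y)\<^sup>2 * (u \<bullet> (A *v u))" .
    moreover have "y \<bullet> y = (norm y)\<^sup>2" by (simp add: power2_norm_eq_inner)
    ultimately show ?thesis using max[OF \<open>norm u = 1\<close>] by (simp add: c_def mult.commute mult_right_mono)
  qed simp
  \<comment> \<open>The residual \<open>z\<close> is half the gradient of the quadratic form along
    the sphere. Moving from \<open>x\<close> in this direction must not violate \<open>le\<close>,
    which forces \<open>z = 0\<close>.\<close>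
  define z where "z = A *v x - c *\<^sub>R x"
  define K where "K = c * (z \<bullet> z) - z \<bullet> (A *v z)"
  have quad: "2 * t * (z \<bullet> z) \<le> t\<^sup>2 * K" for t
  proof -
    let ?y = "x + t *\<^sub>R z"
    have e1: "?y \<bullet> (A *v ?y) = c + 2 * t * (z \<bullet> (A *v x)) + t\<^sup>2 * (z \<bullet> (A *v z))"
      using symmetric_matrix_inner[OF assms, of x z]
      by (simp add: c_def matrix_vector_right_distrib matrix_vector_mult_scaleR inner_add_left
          inner_add_right inner_commute power2_eq_square algebra_simps)
    have e2: "?y \<bullet> ?y = 1 + 2 * t * (z \<bullet> x) + t\<^sup>2 * (z \<bullet> z)"
      using x by (simp add: inner_add_left inner_add_right inner_commute power2_eq_square
          algebra_simps norm_eq_1)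
    have e3: "z \<bullet> (A *v x) = z \<bullet> z + c * (z \<bullet> x)"
      by (simp add: z_def inner_diff_right)
    show ?thesis using le[of ?y] unfolding e1 e2 e3 by (simp add: K_def algebra_simps)
  qed
  have "z \<bullet> z \<le> 0"
  proof (rule ccontr)
    assume "\<not> z \<bullet> z \<le> 0"
    then have pos: "z \<bullet> z > 0" by linarith
    have "2 * (z \<bullet> z) \<le> K" using quad[of 1] by simp
    with pos have "K > 0" by linarith
    \<comment> \<open>This step length turns the bound \<open>t\<^sup>2 * K\<close> of
      \<open>quad\<close> into half of its left-hand side.\<close>
    define t where "t = (z \<bullet> z) / K"
    have "t > 0" "t * K = z \<bullet> z" using pos \<open>K > 0\<close> by (auto simp: t_def)
    then have "2 * (t * (z \<bullet> z)) \<le> t * (z \<bullet> z)"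
      using quad[of t] by (simp add: power2_eq_square mult_ac)
    moreover have "0 < t * (z \<bullet> z)" using \<open>t > 0\<close> pos by (rule mult_pos_pos)
    ultimately show False by linarith
  qed
  then have "z \<bullet> z = 0" using inner_ge_zero[of z] by linarith
  then have "A *v x = c *\<^sub>R x" by (simp add: z_def)
  moreover have "x \<noteq> 0" using x by auto
  ultimately show ?thesis by (auto simp: eigenvalues_def)
qed

lemma transpose_adj_matrix: "transpose (adj_matrix \<Gamma>) = adj_matrix \<Gamma>"
  by (simp add: transpose_def adj_matrix_def vec_eq_iff insert_commute)

lemma index_in_eigenvalues: "index \<Gamma> \<in> eigenvalues (adj_matrix \<Gamma>)"
  unfolding index_def
  using finite_eigenvalues_symmetric eigenvalues_symmetric_nonempty transpose_adj_matrix
  by (intro Max_in) blast+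

lemma eigenvalue_le_index: "c \<in> eigenvalues (adj_matrix \<Gamma>) \<Longrightarrow> c \<le> index \<Gamma>"
  unfolding index_def
  using finite_eigenvalues_symmetric transpose_adj_matrix by (intro Max_ge) blast+

section \<open>Entries and a positive eigenvector of the comparison graph\<close>

lemma adj_C3neg_bullet_K:
  fixes u a b :: "'v::finite"
  assumes "distinct [u, a, b]"
  shows "adj_matrix (C3neg_bullet_K u a b) $ v $ w =
    (if v = w then 0 else if {v, w} = {a, b} then -1
     else if {v, w} \<inter> {a, b} = {} \<or> {v, w} = {u, a} \<or> {v, w} = {u, b} then 1 else 0)"
proof -
  have "{v, w} \<in> edges (C3neg_bullet_K u a b) \<longleftrightarrow> v \<noteq> w \<and>
    ({v, w} \<inter> {a, b} = {} \<or> {v, w} = {u, a} \<or> {v, w} = {u, b} \<or> {v, w} = {a, b})"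
  proof (cases "v = w")
    case True
    then show ?thesis using assms by (auto simp: C3neg_bullet_K_def doubleton_eq_iff)
  next
    case False
    then have "card {v, w} = 2" by simp
    moreover have "{v, w} \<subseteq> - {a, b} \<longleftrightarrow> {v, w} \<inter> {a, b} = {}" by blast
    ultimately show ?thesis using False by (simp add: C3neg_bullet_K_def) blast
  qed
  moreover have "esign (C3neg_bullet_K u a b) = (\<lambda>e. if e = {a, b} then -1 else 1)"
    by (simp add: C3neg_bullet_K_def)
  moreover have "{v, w} = {a, b} \<Longrightarrow> v \<noteq> w" using assms by (auto simp: doubleton_eq_iff)
  ultimately show ?thesis by (simp only: adj_matrix_def vec_lambda_beta) simp
qed

text \<open>The condition on \<open>\<rho>\<close> is the eigenvalue equation at \<open>u\<close> of the quotient matrix of the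
  partition \<open>{u}\<close>, \<open>{a, b}\<close>, rest.\<close>

lemma C3neg_bullet_K_eigenvector:
  fixes u a b :: "'v::finite" and \<rho> :: real
  defines "n \<equiv> real CARD('v)"
  defines "y \<equiv> (\<lambda>v. if v = u then (\<rho> - n + 4) * (\<rho> + 1) else if v = a \<or> v = b then \<rho> - n + 4 else \<rho> + 1)"
  assumes dist: "distinct [u, a, b]"
    and root: "\<rho> * (\<rho> - n + 4) * (\<rho> + 1) = (n - 3) * (\<rho> + 1) + 2 * (\<rho> - n + 4)"
  shows "(\<Sum>w\<in>UNIV. adj_matrix (C3neg_bullet_K u a b) $ v $ w * y w) = \<rho> * y v"
proof -
  let ?R = "- {u, a, b}"
  let ?B = "adj_matrix (C3neg_bullet_K u a b)"
  have cR: "real (card ?R) = n - 3"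
    using dist card_mono[of UNIV "{u, a, b}"]
    by (simp add: Compl_eq_Diff_UNIV card_Diff_subset n_def of_nat_diff)
  have split: "(\<Sum>w\<in>UNIV. g w) = g u + g a + g b + (\<Sum>w\<in>?R. g w)" for g :: "'v \<Rightarrow> real"
  proof -
    have "(\<Sum>w\<in>UNIV. g w) = (\<Sum>w\<in>{u, a, b}. g w) + (\<Sum>w\<in>?R. g w)"
      by (metis Compl_partition finite sum.union_disjoint Compl_disjoint)
    then show ?thesis using dist by simp
  qed
  have R: "y w = \<rho> + 1" if "w \<in> ?R" for w using that by (auto simp: y_def)
  have yu: "y u = (\<rho> - n + 4) * (\<rho> + 1)" "y a = \<rho> - n + 4" "y b = \<rho> - n + 4"
    using dist by (auto simp: y_def)
  note adj = adj_C3neg_bullet_K[OF dist]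
  \<comment> \<open>The values of \<open>y\<close> are chosen so that the equations at
    \<open>a\<close>, \<open>b\<close> and the remaining vertices are identities in \<rho>; the
    equation at \<open>u\<close> is \<open>root\<close>.\<close>
  consider "v = u" | "v = a" | "v = b" | "v \<in> ?R" by auto
  then show ?thesis
  proof cases
    case 1
    have B: "?B $ v $ u = 0" "?B $ v $ a = 1" "?B $ v $ b = 1"
      using 1 dist by (auto simp: adj doubleton_eq_iff)
    have "(\<Sum>w\<in>?R. ?B $ v $ w * y w) = (\<Sum>w\<in>?R. \<rho> + 1)"
      using 1 dist by (intro sum.cong) (auto simp: adj R doubleton_eq_iff)
    then show ?thesis
      using 1 root cR unfolding split B by (simp add: yu algebra_simps)
  next
    case 2
    have B: "?B $ v $ u = 1" "?B $ v $ a = 0" "?B $ v $ b = -1"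
      using 2 dist by (auto simp: adj doubleton_eq_iff)
    have "(\<Sum>w\<in>?R. ?B $ v $ w * y w) = (\<Sum>w\<in>?R. 0)"
      using 2 dist by (intro sum.cong) (auto simp: adj R doubleton_eq_iff)
    then show ?thesis
      using 2 unfolding split B by (simp add: yu algebra_simps)
  next
    case 3
    have B: "?B $ v $ u = 1" "?B $ v $ a = -1" "?B $ v $ b = 0"
      using 3 dist by (auto simp: adj doubleton_eq_iff)
    have "(\<Sum>w\<in>?R. ?B $ v $ w * y w) = (\<Sum>w\<in>?R. 0)"
      using 3 dist by (intro sum.cong) (auto simp: adj R doubleton_eq_iff)
    then show ?thesis
      using 3 unfolding split B by (simp add: yu algebra_simps)
  next
    case 4
    have B: "?B $ v $ u = 1" "?B $ v $ a = 0" "?B $ v $ b = 0"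
      using 4 dist by (auto simp: adj doubleton_eq_iff)
    have "(\<Sum>w\<in>?R. ?B $ v $ w * y w) = (\<Sum>w\<in>?R. (\<rho> + 1) - (if w = v then \<rho> + 1 else 0))"
      using 4 dist by (intro sum.cong) (auto simp: adj R doubleton_eq_iff)
    also have "\<dots> = (n - 3) * (\<rho> + 1) - (\<rho> + 1)"
      using 4 cR by (simp add: sum_subtractf)
    finally show ?thesis
      using R[OF 4] unfolding split B by (simp add: yu algebra_simps)
  qed
qed

text \<open>The cubic is -2 at \<open>n - 3\<close> and nonnegative at \<open>n\<close>. A root
  above \<open>n - 3\<close> makes all entries of the eigenvector positive and bounds the index of
  the comparison graph from below.\<close>

lemma C3neg_bullet_K_root_exists:
  fixes n :: real
  assumes "n \<ge> 3"
  obtains \<rho> where "n - 3 < \<rho>" "\<rho> * (\<rho> - n + 4) * (\<rho> + 1) = (n - 3) * (\<rho> + 1) + 2 * (\<rho> - n + 4)"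
proof -
  define f where "f t = t * (t - n + 4) * (t + 1) - (n - 3) * (t + 1) - 2 * (t - n + 4)" for t
  have lo: "f (n - 3) = - 2" by (simp add: f_def algebra_simps)
  have "f n = 3 * n\<^sup>2 + 6 * n - 5" by (simp add: f_def algebra_simps power2_eq_square)
  moreover have "0 \<le> n\<^sup>2" by simp
  ultimately have hi: "0 \<le> f n" using assms by linarith
  have "continuous_on {n - 3..n} f" unfolding f_def by (intro continuous_intros)
  then obtain \<rho> where \<rho>: "n - 3 \<le> \<rho>" "f \<rho> = 0"
    using IVT'[of f "n - 3" 0 n] lo hi by auto
  with lo have "\<rho> \<noteq> n - 3" by auto
  with \<rho> show thesis by (intro that[of \<rho>]) (auto simp: f_def)
qed

section \<open>Positive paths in a matrix with a nonnegative eigenvector\<close>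

text \<open>In the application \<open>a\<close> is the switched adjacency matrix, \<open>x\<close>
  consists of the absolute values of an eigenvector for the index, divided by their maximum, and
  \<open>h\<close> attains that maximum.\<close>

locale nonneg_eigenvector =
  fixes a :: "'v::finite \<Rightarrow> 'v \<Rightarrow> real" and x :: "'v \<Rightarrow> real" and lam :: real and h :: 'v
  assumes sym: "a v w = a w v"
    and irrefl: "a v v = 0"
    and entries: "a v w \<in> {-1, 0, 1}"
    and nonneg: "0 \<le> x v"
    and le_1: "x v \<le> 1"
    and hub: "x h = 1"
    and eigen: "lam * x v = (\<Sum>w\<in>UNIV. a v w * x w)"
    and large: "real CARD('v) - 3 < lam"
    and card_ge_3: "3 \<le> CARD('v)"
begin

definition pos :: "'v \<Rightarrow> 'v \<Rightarrow> bool" where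
  "pos v w \<longleftrightarrow> a v w = 1"

definition nbrs :: "'v \<Rightarrow> 'v set" where
  "nbrs v = {w. pos v w}"

lemma pos_sym: "pos v w \<longleftrightarrow> pos w v"
  by (simp add: pos_def sym)

lemma pos_irrefl [simp]: "\<not> pos v v"
  by (simp add: pos_def irrefl)

section \<open>Degree and deficit estimates\<close>

lemma not_pos_le_0: "\<not> pos v w \<Longrightarrow> a v w \<le> 0"
  using entries[of v w] by (auto simp: pos_def)

lemma eigen_le_nbrs: "lam * x v \<le> (\<Sum>w\<in>nbrs v. x w)"
proof -
  have "lam * x v \<le> (\<Sum>w\<in>UNIV. if w \<in> nbrs v then x w else 0)"
    unfolding eigen using not_pos_le_0[of v] nonneg
    by (intro sum_mono) (auto simp: nbrs_def pos_def mult_nonpos_nonneg)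
  then show ?thesis by (simp add: sum.If_cases)
qed

lemma eigen_le_nbrs_neg:
  assumes "a v q = -1"
  shows "lam * x v + x q \<le> (\<Sum>w\<in>nbrs v. x w)"
proof -
  have "lam * x v + x q = (\<Sum>w\<in>UNIV. a v w * x w + (if w = q then x q else 0))"
    by (simp add: eigen sum.distrib)
  also have "\<dots> \<le> (\<Sum>w\<in>UNIV. if w \<in> nbrs v then x w else 0)"
    using not_pos_le_0[of v] nonneg assms
    by (intro sum_mono) (auto simp: nbrs_def pos_def mult_nonpos_nonneg)
  finally show ?thesis by (simp add: sum.If_cases)
qed

lemma eigen_le_degree: "lam * x v \<le> card (nbrs v)"
proof -
  have "(\<Sum>w\<in>nbrs v. x w) \<le> (\<Sum>w\<in>nbrs v. 1)"
    by (intro sum_mono le_1)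
  with eigen_le_nbrs[of v] show ?thesis by simp
qed

lemma degree_gt:
  assumes "x v > t" "t \<ge> 0"
  shows "(real CARD('v) - 3) * t < card (nbrs v)"
proof -
  have "(real CARD('v) - 3) * t \<le> (real CARD('v) - 3) * x v"
    using assms card_ge_3 by (intro mult_left_mono) auto
  also have "\<dots> < lam * x v"
    using large assms by (intro mult_strict_right_mono) auto
  finally show ?thesis using eigen_le_degree[of v] by linarith
qed

text \<open>Since \<open>x h = 1\<close>, the degree of the hub exceeds \<open>n - 3\<close>, so it
  is at least \<open>n - 2\<close>.\<close>

lemma hub_misses:
  obtains (none) "\<And>w. w \<noteq> h \<Longrightarrow> pos h w"
  | (one) c where "c \<noteq> h" "\<not> pos h c" "\<And>w. w \<noteq> h \<Longrightarrow> w \<noteq> c \<Longrightarrow> pos h w"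
proof -
  have "h \<notin> nbrs h" by (simp add: nbrs_def)
  let ?M = "- insert h (nbrs h)"
  have "card ?M = CARD('v) - Suc (card (nbrs h))"
    using \<open>h \<notin> nbrs h\<close> by (simp add: Compl_eq_Diff_UNIV card_Diff_subset)
  moreover have "real CARD('v) - 3 < card (nbrs h)"
    using eigen_le_degree[of h] large hub by simp
  ultimately have "card ?M \<le> 1" by linarith
  then consider "?M = {}" | c where "?M = {c}"
    by (metis card_0_eq card_1_singletonE finite le_antisym less_one not_le)
  then show thesis
  proof cases
    case 1
    then show thesis using none by (auto simp: nbrs_def)
  next
    case (2 c)
    then have "\<And>w. (w \<noteq> h \<and> \<not> pos h w) \<longleftrightarrow> w = c"
      by (auto simp: nbrs_def)
    then show thesis using one by blast
  qed
qed

text \<open>The neighbours of \<open>h\<close> have total weight at least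
  \<open>lam > n - 3\<close>, and \<open>h\<close> adds 1; so the \<open>n\<close> weights sum to
  more than \<open>n - 2\<close>.\<close>

lemma deficit_less_2: "(\<Sum>v\<in>T. 1 - x v) < 2"
proof -
  have "(\<Sum>v\<in>T. 1 - x v) \<le> (\<Sum>v\<in>UNIV. 1 - x v)"
    using le_1 by (intro sum_mono2) auto
  moreover have "(\<Sum>w\<in>nbrs h. x w) + 1 \<le> (\<Sum>v\<in>UNIV. x v)"
  proof -
    have "(\<Sum>w\<in>nbrs h. x w) + 1 = (\<Sum>w\<in>insert h (nbrs h). x w)"
      by (simp add: nbrs_def hub)
    also have "\<dots> \<le> (\<Sum>v\<in>UNIV. x v)"
      using nonneg by (intro sum_mono2) auto
    finally show ?thesis .
  qed
  ultimately show ?thesis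
    using eigen_le_nbrs[of h] hub large by (simp add: sum_subtractf)
qed

text \<open>As \<open>c\<close> is no positive neighbour of \<open>h\<close>, the weight above
  \<open>n - 2\<close> already sits on the \<open>n - 1\<close> vertices other than
  \<open>c\<close>.\<close>

lemma deficit_less_1:
  assumes "c \<noteq> h" "\<not> pos h c" "c \<notin> T"
  shows "(\<Sum>v\<in>T. 1 - x v) < 1"
proof -
  have "(\<Sum>v\<in>T. 1 - x v) \<le> (\<Sum>v\<in>UNIV - {c}. 1 - x v)"
    using le_1 assms by (intro sum_mono2) auto
  also have "\<dots> = CARD('v) - 1 - (\<Sum>v\<in>UNIV - {c}. x v)"
    by (simp add: sum_subtractf card_Diff_subset of_nat_diff Suc_leI)
  moreover have "(\<Sum>w\<in>nbrs h. x w) + 1 \<le> (\<Sum>v\<in>UNIV - {c}. x v)"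
  proof -
    have "(\<Sum>w\<in>nbrs h. x w) + 1 = (\<Sum>w\<in>insert h (nbrs h). x w)"
      by (simp add: nbrs_def hub)
    also have "\<dots> \<le> (\<Sum>v\<in>UNIV - {c}. x v)"
      using nonneg assms by (intro sum_mono2) (auto simp: nbrs_def)
    finally show ?thesis .
  qed
  ultimately show ?thesis
    using eigen_le_nbrs[of h] hub large by simp
qed

text \<open>Each such vertex has deficit at least 2/3, so three of them would exhaust the bound
  2.\<close>

lemma small_card_le_2: "card {v. x v \<le> 1/3} \<le> 2"
proof -
  let ?L = "{v. x v \<le> 1/3}"
  have "(\<Sum>v\<in>?L. 2/3) \<le> (\<Sum>v\<in>?L. 1 - x v)"
    by (intro sum_mono) auto
  with deficit_less_2[of ?L] show ?thesis by simp
qed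

lemma small_card_le_1:
  assumes "c \<noteq> h" "\<not> pos h c"
  shows "card {v. v \<noteq> c \<and> x v \<le> 1/2} \<le> 1"
proof -
  let ?L = "{v. v \<noteq> c \<and> x v \<le> 1/2}"
  have "(\<Sum>v\<in>?L. 1/2) \<le> (\<Sum>v\<in>?L. 1 - x v)"
    by (intro sum_mono) auto
  with deficit_less_1[OF assms, of ?L] show ?thesis by simp
qed

text \<open>Without positive neighbours of \<open>p\<close>, the eigenvalue equation forces
  \<open>x p = x q = 0\<close>, a total deficit of 2.\<close>

lemma neg_edge_has_nbr:
  assumes "a p q = -1"
  shows "nbrs p \<noteq> {}"
proof
  assume "nbrs p = {}"
  then have "lam * x p + x q \<le> 0"
    using eigen_le_nbrs_neg[OF assms] by simp
  moreover have "p \<noteq> q" using assms irrefl by auto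
  moreover have "lam > 0" using large card_ge_3 by simp
  ultimately have "x p = 0" "x q = 0"
    using nonneg[of p] nonneg[of q]
    by (smt (verit) mult_pos_pos mult_nonneg_nonneg)+
  moreover have "(\<Sum>v\<in>{p, q}. 1 - x v) < 2" by (rule deficit_less_2)
  ultimately show False using \<open>p \<noteq> q\<close> by simp
qed

section \<open>Positive paths and their growth\<close>

definition pos_path :: "'v list \<Rightarrow> bool" where
  "pos_path vs \<longleftrightarrow> vs \<noteq> [] \<and> distinct vs \<and> successively pos vs"

text \<open>Two disjoint positive paths that grow at their heads away from \<open>p\<close> and \<open>q\<close>; once both heads
  are neighbours of the hub, they join to a path from \<open>p\<close> to \<open>q\<close> through it.\<close>

definition path_pair :: "'v \<Rightarrow> 'v \<Rightarrow> 'v list \<Rightarrow> 'v list \<Rightarrow> bool" where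
  "path_pair p q as bs \<longleftrightarrow> pos_path as \<and> pos_path bs \<and> last as = p \<and> last bs = q \<and>
     set as \<inter> set bs = {} \<and> h \<notin> set as \<and> h \<notin> set bs"

lemma pos_path_Cons:
  "pos_path vs \<Longrightarrow> z \<notin> set vs \<Longrightarrow> pos (hd vs) z \<Longrightarrow> pos_path (z # vs)"
  by (cases vs) (auto simp: pos_path_def pos_sym)

lemma pos_path_rev: "pos_path vs \<Longrightarrow> pos_path (rev vs)"
proof -
  have swap: "(\<lambda>v w. pos w v) = pos" using pos_sym by blast
  have "successively pos (rev vs) \<longleftrightarrow> successively pos vs"
    unfolding successively_rev swap ..
  then show "pos_path vs \<Longrightarrow> pos_path (rev vs)" by (simp add: pos_path_def)
qed

lemma path_pair_swap: "path_pair p q as bs \<Longrightarrow> path_pair q p bs as"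
  by (auto simp: path_pair_def)

lemma path_pair_Cons:
  "path_pair p q as bs \<Longrightarrow> z \<notin> set as \<union> set bs \<union> {h} \<Longrightarrow> pos (hd as) z \<Longrightarrow> path_pair p q (z # as) bs"
  by (auto simp: path_pair_def pos_path_Cons) (auto simp: pos_path_def)

lemma path_pair_join:
  assumes "path_pair p q as bs" "pos h (hd as)" "pos h (hd bs)"
  shows "\<exists>vs. pos_path vs \<and> hd vs = p \<and> last vs = q \<and> length vs = length as + length bs + 1"
proof (intro exI conjI)
  let ?vs = "rev as @ h # bs"
  have ne: "as \<noteq> []" "bs \<noteq> []" using assms(1) by (auto simp: path_pair_def pos_path_def)
  show "pos_path ?vs"
    using assms pos_path_rev[of as] ne
    by (auto simp: path_pair_def pos_path_def successively_append_iff last_rev pos_sym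
        successively_Cons)
  show "hd ?vs = p" "last ?vs = q"
    using assms(1) ne by (auto simp: path_pair_def hd_append hd_rev)
  show "length ?vs = length as + length bs + 1" by simp
qed

text \<open>Counts the vertices that a step from the head must avoid; the head is left out because
  it is no neighbour of itself.\<close>

lemma card_path_pair:
  assumes "path_pair p q as bs"
  shows "card ((set as \<union> set bs \<union> {h}) - {hd as}) = length as + length bs"
proof -
  have "card (set as \<union> set bs \<union> {h}) = length as + length bs + 1"
    using assms
    by (auto simp: path_pair_def pos_path_def card_Un_disjoint distinct_card)
  moreover have "hd as \<in> set as \<union> set bs \<union> {h}"
    using assms by (auto simp: path_pair_def pos_path_def)
  ultimately show ?thesis by simp
qed

lemma path_pair_extend:
  assumes "path_pair p q as bs" "length as + length bs + card Z < card (nbrs (hd as))"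
  obtains z where "pos (hd as) z" "z \<notin> Z" "z \<notin> set as \<union> set bs \<union> {h}" "path_pair p q (z # as) bs"
proof -
  let ?C = "((set as \<union> set bs \<union> {h}) - {hd as}) \<union> Z"
  have "card ?C \<le> length as + length bs + card Z"
    using card_Un_le[of "(set as \<union> set bs \<union> {h}) - {hd as}" Z] card_path_pair[OF assms(1)]
    by simp
  with assms(2) have "\<not> nbrs (hd as) \<subseteq> ?C"
    using card_mono[OF finite, of "nbrs (hd as)" ?C] by linarith
  then obtain z where z: "pos (hd as) z" "z \<notin> ?C" by (auto simp: nbrs_def)
  then have "z \<noteq> hd as" by auto
  with z have "z \<notin> set as \<union> set bs \<union> {h}" by auto
  with z show thesis using that path_pair_Cons[OF assms(1)] by auto
qed

text \<open>Two heads other than \<open>c\<close> have deficits summing to less than 1, so one has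
  weight above 1/2. Its degree exceeds \<open>(n - 3) / 2\<close>, which is at least
  \<open>m\<close> for \<open>n \<ge> 9\<close>; hence it has a fresh neighbour other than
  \<open>c\<close>. Avoiding \<open>c\<close> keeps both heads joinable to the hub.\<close>

lemma grow_pair_missing:
  assumes c: "c \<noteq> h" "\<not> pos h c" and m: "3 * m \<le> CARD('v)" "9 \<le> CARD('v)"
  shows "path_pair p q as bs \<Longrightarrow> hd as \<noteq> c \<Longrightarrow> hd bs \<noteq> c \<Longrightarrow> length as + length bs \<le> m \<Longrightarrow>
    \<exists>as bs. path_pair p q as bs \<and> hd as \<noteq> c \<and> hd bs \<noteq> c \<and> length as + length bs = m"
proof (induction "m - (length as + length bs)" arbitrary: p q as bs)
  case 0
  then show ?case by (intro exI[of _ as] exI[of _ bs]) auto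
next
  case (Suc k)
  have step: "\<exists>as bs. path_pair p' q' as bs \<and> hd as \<noteq> c \<and> hd bs \<noteq> c \<and> length as + length bs = m"
    if P: "path_pair p' q' as' bs'" "hd as' \<noteq> c" "hd bs' \<noteq> c"
      "length as' + length bs' = length as + length bs" and x: "x (hd as') > 1/2" for p' q' as' bs'
  proof -
    have "(real CARD('v) - 3) * (1/2) < card (nbrs (hd as'))"
      by (rule degree_gt[OF x]) simp
    moreover have "length as' + length bs' + 1 \<le> m" using Suc.hyps(2) P(4) by simp
    ultimately have "length as' + length bs' + card {c} < card (nbrs (hd as'))"
      using m by simp
    from path_pair_extend[OF P(1) this] obtain z where "z \<notin> {c}" and z: "path_pair p' q' (z # as') bs'"
      by blast
    then have "z \<noteq> c" by simp
    show ?thesis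
      by (rule Suc.hyps(1)[OF _ z])
        (use P Suc.hyps(2) \<open>z \<noteq> c\<close> in auto)
  qed
  have "as \<noteq> []" "bs \<noteq> []" "set as \<inter> set bs = {}"
    using Suc.prems(1) by (auto simp: path_pair_def pos_path_def)
  then have "hd as \<noteq> hd bs" by (metis disjoint_iff hd_in_set)
  moreover have "(\<Sum>v\<in>{hd as, hd bs}. 1 - x v) < 1"
    using Suc.prems by (intro deficit_less_1[OF c]) auto
  ultimately consider "x (hd as) > 1/2" | "x (hd bs) > 1/2" by force
  then show ?case
  proof cases
    case 1
    then show ?thesis using step[of p q as bs] Suc.prems by auto
  next
    case 2
    with Suc.prems path_pair_swap[of p q as bs] have
      "\<exists>as bs. path_pair q p as bs \<and> hd as \<noteq> c \<and> hd bs \<noteq> c \<and> length as + length bs = m"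
      by (intro step[of q p bs as]) auto
    then obtain as' bs' where "path_pair q p as' bs'" "hd as' \<noteq> c" "hd bs' \<noteq> c" "length as' + length bs' = m"
      by blast
    with path_pair_swap show ?thesis
      by (intro exI[of _ bs'] exI[of _ as']) auto
  qed
qed

text \<open>Growth avoids one of the at most two vertices of \<open>L\<close> until the last step, so at most one of the
  two paths gets stuck, at the other vertex of \<open>L\<close>; then the second path continues.\<close>

lemma grow_pair_full:
  fixes L defines "L \<equiv> {v. x v \<le> 1/3}"
  assumes m: "3 * m \<le> CARD('v)"
  shows "path_pair p q as bs \<Longrightarrow> length as + length bs \<le> m \<Longrightarrow>
    hd as \<notin> L \<and> hd bs \<notin> L \<or> (hd as \<notin> L \<or> hd bs \<notin> L) \<and> card (L - (set as \<union> set bs)) \<le> 1 \<Longrightarrow>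
    \<exists>as bs. path_pair p q as bs \<and> length as + length bs = m"
proof (induction "m - (length as + length bs)" arbitrary: p q as bs)
  case 0
  then show ?case by (intro exI[of _ as] exI[of _ bs]) auto
next
  case (Suc k)
  have step: "\<exists>as bs. path_pair p' q' as bs \<and> length as + length bs = m"
    if P: "path_pair p' q' as' bs'" "length as' + length bs' = length as + length bs" "hd as' \<notin> L"
      "hd bs' \<notin> L \<or> card (L - (set as' \<union> set bs')) \<le> 1" for p' q' as' bs'
  proof -
    have "(real CARD('v) - 3) * (1/3) < card (nbrs (hd as'))"
      using P(3) by (intro degree_gt) (auto simp: L_def)
    moreover have "length as' + length bs' + 1 \<le> m" using Suc.hyps(2) P(2) by simp
    \<comment> \<open>This degree suffices to avoid the vertices already used, and one further
      vertex unless this is the last step, \<open>k = 0\<close>.\<close>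
    ultimately have deg: "m \<le> card (nbrs (hd as'))" using m by simp
    show ?thesis
    proof (cases "k = 0")
      case True
      then have "length as' + length bs' + card {} < card (nbrs (hd as'))"
        using Suc.hyps(2) P(2) deg by simp
      from path_pair_extend[OF P(1) this] obtain z where "path_pair p' q' (z # as') bs'"
        by blast
      with True Suc.hyps(2) P(2) show ?thesis by (intro exI[of _ "z # as'"] exI[of _ bs']) auto
    next
      case False
      let ?L = "L - (set as' \<union> set bs')"
      have "card ?L \<le> 2"
        using card_mono[of L ?L] small_card_le_2 by (simp add: L_def)
      \<comment> \<open>\<open>v\<close> is the last vertex of \<open>L\<close> off the paths if at
        most one is left; otherwise it is arbitrary.\<close>
      obtain v where v: "card ?L \<le> 1 \<Longrightarrow> ?L \<subseteq> {v}"
      proof (cases "card ?L \<le> 1")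
        case True
        then have "\<And>v w. v \<in> ?L \<Longrightarrow> w \<in> ?L \<Longrightarrow> v = w"
          using card_le_Suc0_iff_eq[of ?L] by simp
        then show thesis using that by (cases "?L = {}") blast+
      qed auto
      have "length as' + length bs' + card {v} < card (nbrs (hd as'))"
        using Suc.hyps(2) P(2) deg False by simp
      from path_pair_extend[OF P(1) this] obtain z where
        z: "z \<notin> {v}" "z \<notin> set as' \<union> set bs' \<union> {h}" "path_pair p' q' (z # as') bs'"
        by blast
      \<comment> \<open>The new head can enter \<open>L\<close> only if two vertices of
        \<open>L\<close> were left. Then the other head lies outside \<open>L\<close>, and one
        vertex of \<open>L\<close> remains.\<close>
      have inv: "z \<notin> L \<and> hd bs' \<notin> L \<or> (z \<notin> L \<or> hd bs' \<notin> L) \<and> card (L - (set (z # as') \<union> set bs')) \<le> 1"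
      proof (cases "z \<in> L")
        case True
        with z v have "\<not> card ?L \<le> 1" by auto
        then have "hd bs' \<notin> L" "card ?L = 2" using P(4) \<open>card ?L \<le> 2\<close> by auto
        moreover have "L - (set (z # as') \<union> set bs') = ?L - {z}" by auto
        moreover have "z \<in> ?L" using True z by auto
        ultimately show ?thesis by (simp only: card_Diff_singleton) simp
      next
        case False
        have "card (L - (set (z # as') \<union> set bs')) \<le> card ?L" by (intro card_mono) auto
        with False P(4) show ?thesis by auto
      qed
      show ?thesis
        by (rule Suc.hyps(1)[OF _ z(3)]) (use Suc.hyps(2) P(2) False inv in auto)
    qed
  qed
  show ?case
  proof (cases "hd as \<notin> L")
    case True
    then show ?thesis using step[of p q as bs] Suc.prems by auto
  next
    case False
    with Suc.prems path_pair_swap[of p q as bs] have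
      "\<exists>as bs. path_pair q p as bs \<and> length as + length bs = m"
      by (intro step[of q p bs as]) (auto simp: Un_commute)
    then obtain as' bs' where "path_pair q p as' bs'" "length as' + length bs' = m"
      by blast
    with path_pair_swap show ?thesis
      by (intro exI[of _ bs'] exI[of _ as']) auto
  qed
qed

text \<open>Serves the case that \<open>h\<close> is an end of the negative edge; the other end is
  \<open>c\<close>, already on the path. New heads keep weight above 1/2, which at most one vertex
  other than \<open>c\<close> fails, so at most \<open>length as + 1\<close> vertices are to be
  avoided.\<close>

lemma grow_path_missing:
  assumes c: "c \<noteq> h" "\<not> pos h c" and m: "3 * m \<le> CARD('v)" "9 \<le> CARD('v)"
  shows "pos_path as \<Longrightarrow> h \<notin> set as \<Longrightarrow> c \<in> set as \<Longrightarrow> hd as \<noteq> c \<Longrightarrow> x (hd as) > 1/2 \<Longrightarrow>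
    length as \<le> m \<Longrightarrow>
    \<exists>as'. pos_path as' \<and> last as' = last as \<and> h \<notin> set as' \<and> hd as' \<noteq> c \<and> length as' = m"
proof (induction "m - length as" arbitrary: as)
  case 0
  then show ?case by (intro exI[of _ as]) auto
next
  case (Suc k)
  let ?W = "{v. v \<noteq> c \<and> x v \<le> 1/2}"
  let ?C = "insert h (set as) - {hd as} \<union> ?W"
  have "as \<noteq> []" "distinct as" using Suc.prems(1) by (auto simp: pos_path_def)
  have "(real CARD('v) - 3) * (1/2) < card (nbrs (hd as))"
    by (rule degree_gt) (use Suc.prems in auto)
  moreover have "length as + 1 \<le> m" using Suc.hyps(2) by simp
  moreover have "card ?C \<le> length as + 1"
  proof -
    have "card (insert h (set as) - {hd as}) = length as"
      using Suc.prems \<open>as \<noteq> []\<close> \<open>distinct as\<close> by (simp add: distinct_card)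
    then show ?thesis
      using card_Un_le[of "insert h (set as) - {hd as}" ?W] small_card_le_1[OF c] by linarith
  qed
  ultimately have "card ?C < card (nbrs (hd as))"
    using m by simp
  then have "\<not> nbrs (hd as) \<subseteq> ?C"
    using card_mono[OF finite, of "nbrs (hd as)" ?C] by linarith
  then obtain z where z: "pos (hd as) z" "z \<notin> ?C" by (auto simp: nbrs_def)
  then have "z \<noteq> hd as" by auto
  with z Suc.prems have z': "z \<notin> set as" "z \<noteq> h" "x z > 1/2" "z \<noteq> c" by auto
  have "\<exists>as'. pos_path as' \<and> last as' = last (z # as) \<and> h \<notin> set as' \<and> hd as' \<noteq> c \<and> length as' = m"
    by (rule Suc.hyps(1)) (use Suc z z' pos_path_Cons in auto)
  then show ?case using \<open>as \<noteq> []\<close> by simp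
qed

section \<open>Positive paths of length \<open>r\<close> between the ends of a negative edge\<close>

lemma long_path_hub:
  assumes neg: "a p h = -1" and m: "4 \<le> r" "3 * (r - 1) \<le> CARD('v)"
  shows "\<exists>vs. pos_path vs \<and> hd vs = p \<and> last vs = h \<and> length vs = r"
proof -
  \<comment> \<open>The edge \<open>p h\<close> is negative, so \<open>p\<close> is the one vertex
    that the hub misses.\<close>
  have ph: "p \<noteq> h" "\<not> pos h p" using neg irrefl by (auto simp: pos_def sym[of h p])
  have hub': "pos h w" if "w \<noteq> h" "w \<noteq> p" for w
    using ph that by (cases rule: hub_misses) metis+
  \<comment> \<open>Otherwise \<open>p\<close> has at most one positive neighbour, of weight at most
    1/2, whereas the negative edge to \<open>h\<close> demands total weight at least
    \<open>x h = 1\<close>.\<close>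
  have "\<exists>p'\<in>nbrs p. x p' > 1/2"
  proof (rule ccontr)
    assume "\<not> (\<exists>p'\<in>nbrs p. x p' > 1/2)"
    then have sub: "nbrs p \<subseteq> {v. v \<noteq> p \<and> x v \<le> 1/2}" and small: "\<And>w. w \<in> nbrs p \<Longrightarrow> x w \<le> 1/2"
      by (auto simp: nbrs_def not_less)
    have "card (nbrs p) \<le> 1"
      using card_mono[OF finite sub] small_card_le_1[OF ph] by linarith
    moreover have "(\<Sum>w\<in>nbrs p. x w) \<le> of_nat (card (nbrs p)) * (1/2)"
      using small by (rule sum_bounded_above)
    moreover have "0 \<le> lam * x p" using nonneg large card_ge_3 by simp
    ultimately show False using eigen_le_nbrs_neg[OF neg] hub by simp
  qed
  then obtain p' where p': "pos p p'" "x p' > 1/2" by (auto simp: nbrs_def)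
  then have "p' \<noteq> h" "p' \<noteq> p" using ph pos_sym by auto
  have "\<exists>as'. pos_path as' \<and> last as' = last [p', p] \<and> h \<notin> set as' \<and> hd as' \<noteq> p \<and> length as' = r - 1"
    by (rule grow_path_missing[OF ph])
      (use m p' ph \<open>p' \<noteq> h\<close> \<open>p' \<noteq> p\<close> in \<open>auto simp: pos_path_def pos_sym\<close>)
  then obtain as where as: "pos_path as" "last as = p" "h \<notin> set as" "hd as \<noteq> p" "length as = r - 1"
    by auto
  have ne: "as \<noteq> []" using as by (auto simp: pos_path_def)
  then have "hd as \<noteq> h" using as(3) by (metis hd_in_set)
  then have "pos_path (rev as @ [h])"
    using as pos_path_rev[of as] hub'[of "hd as"] ne
    by (auto simp: pos_path_def successively_append_iff last_rev pos_sym)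
  then show ?thesis
    using as ne m by (intro exI[of _ "rev as @ [h]"]) (auto simp: hd_append hd_rev)
qed

text \<open>The hub lies off the edge \<open>p q\<close> and misses \<open>c\<close>. The case
  \<open>c = p\<close> follows by exchanging \<open>p\<close> and \<open>q\<close> and reversing the
  path.\<close>

lemma long_path_missing:
  assumes neg: "a p q = -1" and m: "4 \<le> r" "3 * (r - 1) \<le> CARD('v)"
    and h: "h \<noteq> p" "h \<noteq> q" and c: "c \<noteq> h" "\<not> pos h c" "c \<noteq> p"
    and hub': "\<And>w. w \<noteq> h \<Longrightarrow> w \<noteq> c \<Longrightarrow> pos h w"
  shows "\<exists>vs. pos_path vs \<and> hd vs = p \<and> last vs = q \<and> length vs = r"
proof -
  have pq: "p \<noteq> q" "\<not> pos q p" using neg irrefl by (auto simp: pos_def sym[of q p])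
  have "\<exists>as bs. path_pair p q as bs \<and> hd as \<noteq> c \<and> hd bs \<noteq> c \<and> length as + length bs \<le> r - 1"
  proof (cases "c = q")
    case False
    then show ?thesis
      using pq h c m by (intro exI[of _ "[p]"] exI[of _ "[q]"]) (auto simp: path_pair_def pos_path_def)
  next
    case True
    \<comment> \<open>A head at \<open>c\<close> could not be joined to the hub, so the path from
      \<open>q = c\<close> first moves to a positive neighbour, which is not
      \<open>h\<close>.\<close>
    obtain q' where q': "pos q q'"
      using neg_edge_has_nbr[of q p] neg sym[of p q] by (auto simp: nbrs_def)
    then have "q' \<noteq> h" "q' \<noteq> p" "q' \<noteq> q" using True c pq pos_sym by auto
    then show ?thesis
      using pq h c m q' True pos_sym[of q q']
      by (intro exI[of _ "[p]"] exI[of _ "[q', q]"]) (auto simp: path_pair_def pos_path_def)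
  qed
  then obtain as bs where "path_pair p q as bs" "hd as \<noteq> c" "hd bs \<noteq> c" "length as + length bs \<le> r - 1"
    by blast
  then have "\<exists>as bs. path_pair p q as bs \<and> hd as \<noteq> c \<and> hd bs \<noteq> c \<and> length as + length bs = r - 1"
    by (rule grow_pair_missing[OF c(1,2) m(2), rotated]) (use m in auto)
  then obtain as bs where P: "path_pair p q as bs" "hd as \<noteq> c" "hd bs \<noteq> c" "length as + length bs = r - 1"
    by blast
  moreover have "hd as \<noteq> h" "hd bs \<noteq> h"
    using P(1) hd_in_set unfolding path_pair_def pos_path_def by metis+
  ultimately show ?thesis
    using path_pair_join[OF P(1)] hub' m by auto
qed

lemma pos_path_reverse:
  "\<exists>vs. pos_path vs \<and> hd vs = p \<and> last vs = q \<and> length vs = r \<Longrightarrow>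
    \<exists>vs. pos_path vs \<and> hd vs = q \<and> last vs = p \<and> length vs = r"
  by (metis hd_rev last_rev length_rev pos_path_rev)

text \<open>The hub is adjacent to all other vertices. Assumption \<open>ex\<close> rules out that
  both paths are stuck at their starts, so the invariant of \<open>grow_pair_full\<close> can be
  established.\<close>

lemma long_path_full:
  assumes neg: "a p q = -1" and m: "4 \<le> r" "3 * (r - 1) \<le> CARD('v)"
    and h: "h \<noteq> p" "h \<noteq> q" and hub': "\<And>w. w \<noteq> h \<Longrightarrow> pos h w"
    and ex: "\<not> (nbrs p \<subseteq> {h} \<and> nbrs q \<subseteq> {h} \<and> {v. x v \<le> 1/3} = {p, q})"
  shows "\<exists>vs. pos_path vs \<and> hd vs = p \<and> last vs = q \<and> length vs = r"
proof -
  let ?L = "{v. x v \<le> 1/3}"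
  have pq: "p \<noteq> q" "\<not> pos q p" "\<not> pos p q" using neg irrefl by (auto simp: pos_def sym[of q p])
  have "\<exists>as bs. path_pair p q as bs \<and> length as + length bs \<le> r - 1 \<and>
    (hd as \<notin> ?L \<and> hd bs \<notin> ?L \<or> (hd as \<notin> ?L \<or> hd bs \<notin> ?L) \<and> card (?L - (set as \<union> set bs)) \<le> 1)"
  proof (cases "p \<in> ?L \<and> q \<in> ?L")
    case True
    then have "{p, q} \<subseteq> ?L" by simp
    \<comment> \<open>Now \<open>p\<close> and \<open>q\<close> exhaust \<open>?L\<close>, so any
      neighbour of theirs other than \<open>h\<close> is a head from which growth can
      continue.\<close>
    then have L: "?L = {p, q}"
      by (intro card_seteq[symmetric]) (use small_card_le_2 pq in auto)
    with ex consider z where "pos p z" "z \<noteq> h" | z where "pos q z" "z \<noteq> h"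
      by (auto simp: nbrs_def)
    then show ?thesis
    proof cases
      case (1 z)
      then have "z \<noteq> p" "z \<noteq> q" using pq by auto
      then have "z \<notin> ?L" using L by blast
      have "path_pair p q [z, p] [q]"
        using pq h 1 pos_sym[of p z] \<open>z \<noteq> p\<close> \<open>z \<noteq> q\<close> by (auto simp: path_pair_def pos_path_def)
      moreover have "length [z, p] + length [q] \<le> r - 1" using m by simp
      moreover have "hd [z, p] \<notin> ?L" using \<open>z \<notin> ?L\<close> by simp
      moreover have "card (?L - (set [z, p] \<union> set [q])) \<le> 1" unfolding L by simp
      ultimately show ?thesis by blast
    next
      case (2 z)
      then have "z \<noteq> p" "z \<noteq> q" using pq by auto
      then have "z \<notin> ?L" using L by blast
      have "path_pair p q [p] [z, q]"
        using pq h 2 pos_sym[of q z] \<open>z \<noteq> p\<close> \<open>z \<noteq> q\<close> by (auto simp: path_pair_def pos_path_def)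
      moreover have "length [p] + length [z, q] \<le> r - 1" using m by simp
      moreover have "hd [z, q] \<notin> ?L" using \<open>z \<notin> ?L\<close> by simp
      moreover have "card (?L - (set [p] \<union> set [z, q])) \<le> 1" unfolding L by simp
      ultimately show ?thesis by blast
    qed
  next
    case False
    have "card (?L - ({p} \<union> {q})) \<le> 1" if "p \<in> ?L \<or> q \<in> ?L"
    proof -
      have "?L - ({p} \<union> {q}) \<subset> ?L" using that by blast
      then have "card (?L - ({p} \<union> {q})) < card ?L" by (intro psubset_card_mono) auto
      then show ?thesis using small_card_le_2 by linarith
    qed
    with False have "p \<notin> ?L \<and> q \<notin> ?L \<or> (p \<notin> ?L \<or> q \<notin> ?L) \<and> card (?L - ({p} \<union> {q})) \<le> 1"
      by blast
    moreover have "path_pair p q [p] [q]" using pq h by (auto simp: path_pair_def pos_path_def)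
    ultimately show ?thesis
      using m by (intro exI[of _ "[p]"] exI[of _ "[q]"]) simp
  qed
  then obtain as bs where "path_pair p q as bs" "length as + length bs \<le> r - 1"
    "hd as \<notin> ?L \<and> hd bs \<notin> ?L \<or> (hd as \<notin> ?L \<or> hd bs \<notin> ?L) \<and> card (?L - (set as \<union> set bs)) \<le> 1"
    by blast
  from grow_pair_full[OF m(2) this]
  obtain as bs where P: "path_pair p q as bs" "length as + length bs = r - 1"
    by blast
  moreover have "hd as \<noteq> h" "hd bs \<noteq> h"
    using P(1) hd_in_set unfolding path_pair_def pos_path_def by metis+
  ultimately show ?thesis
    using path_pair_join[OF P(1)] hub' m by auto
qed

text \<open>The positivity in the exceptional case feeds the later comparison, which yields equality
  of entries in the columns where \<open>x\<close> is positive.\<close>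

proposition long_path_or_exceptional:
  assumes neg: "a p q = -1" and m: "4 \<le> r" "3 * (r - 1) \<le> CARD('v)"
  obtains (path) vs where "pos_path vs" "hd vs = p" "last vs = q" "length vs = r"
  | (exceptional) "h \<noteq> p" "h \<noteq> q" "nbrs p \<subseteq> {h}" "nbrs q \<subseteq> {h}" "\<And>v. v \<noteq> p \<Longrightarrow> v \<noteq> q \<Longrightarrow> 0 < x v"
proof -
  have neg': "a q p = -1" using neg sym by simp
  have "(\<exists>vs. pos_path vs \<and> hd vs = p \<and> last vs = q \<and> length vs = r) \<or>
    h \<noteq> p \<and> h \<noteq> q \<and> nbrs p \<subseteq> {h} \<and> nbrs q \<subseteq> {h} \<and> {v. x v \<le> 1/3} = {p, q}"
  proof (cases "h = p \<or> h = q")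
    case True
    then show ?thesis
      using long_path_hub[of p r] pos_path_reverse[OF long_path_hub[of q r]] neg neg' m by auto
  next
    case False
    then have h: "h \<noteq> p" "h \<noteq> q" by auto
    show ?thesis
    proof (cases rule: hub_misses)
      case none
      show ?thesis using long_path_full[OF neg m h none] h by blast
    next
      case (one c)
      show ?thesis
      proof (cases "c = p")
        case False
        show ?thesis using long_path_missing[OF neg m h one(1,2) False one(3)] by blast
      next
        case True
        moreover have "p \<noteq> q" using neg irrefl by auto
        ultimately have "c \<noteq> q" by simp
        show ?thesis
          using pos_path_reverse[OF long_path_missing[OF neg' m h(2,1) one(1,2) \<open>c \<noteq> q\<close> one(3)]]
          by blast
      qed
    qed
  qed
  then show thesis
  proof (elim disjE exE conjE)
    assume *: "h \<noteq> p" "h \<noteq> q" "nbrs p \<subseteq> {h}" "nbrs q \<subseteq> {h}" "{v. x v \<le> 1/3} = {p, q}"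
    have "0 < x v" if "v \<noteq> p" "v \<noteq> q" for v
      using *(5) that by (cases "x v \<le> 1/3") auto
    with * show thesis by (intro exceptional) auto
  qed (rule path)
qed

end

section \<open>Switching\<close>

text \<open>This is \<open>D A D\<close> for the diagonal matrix \<open>D\<close> of the signs
  \<open>s\<close>: the adjacency matrix after switching at the vertices of sign -1.\<close>

definition switched_adj :: "('v \<Rightarrow> real) \<Rightarrow> 'v::finite sgraph \<Rightarrow> 'v \<Rightarrow> 'v \<Rightarrow> real" where
  "switched_adj s \<Gamma> v w = s v * s w * adj_matrix \<Gamma> $ v $ w"

lemma adj_matrix_eq_0_iff:
  "signed_graph \<Gamma> \<Longrightarrow> adj_matrix \<Gamma> $ v $ w = 0 \<longleftrightarrow> {v, w} \<notin> edges \<Gamma>"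
  by (auto simp: adj_matrix_def signed_graph_def)

lemma switched_adj_props:
  assumes "signed_graph \<Gamma>" "\<And>v. s v \<in> {-1, 1}"
  shows "switched_adj s \<Gamma> v w = switched_adj s \<Gamma> w v"
    and "switched_adj s \<Gamma> v v = 0"
    and "switched_adj s \<Gamma> v w \<in> {-1, 0, 1}"
    and "switched_adj s \<Gamma> v w = 0 \<longleftrightarrow> {v, w} \<notin> edges \<Gamma>"
proof -
  show "switched_adj s \<Gamma> v w = switched_adj s \<Gamma> w v"
    by (simp add: switched_adj_def adj_matrix_def insert_commute)
  show "switched_adj s \<Gamma> v v = 0"
    using assms(1) by (auto simp: switched_adj_def adj_matrix_def signed_graph_def)
  have s: "s v * s w \<in> {-1, 1}" using assms(2)[of v] assms(2)[of w] by auto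
  then show "switched_adj s \<Gamma> v w \<in> {-1, 0, 1}"
    using assms(1) by (auto simp: switched_adj_def adj_matrix_def signed_graph_def)
  show "switched_adj s \<Gamma> v w = 0 \<longleftrightarrow> {v, w} \<notin> edges \<Gamma>"
    using s adj_matrix_eq_0_iff[OF assms(1)] by (auto simp: switched_adj_def)
qed

text \<open>Each vertex lies on two edges of the cycle, so its sign occurs twice and cancels. The
  closing edge is split off since it will be the only negative one.\<close>

lemma cycle_sign_switched_adj:
  assumes s: "\<And>v. s v \<in> {-1, 1}" and vs: "length vs = Suc m"
    and edges: "\<And>i. i < Suc m \<Longrightarrow> cyc_edge vs i \<in> edges \<Gamma>"
  shows "real_of_int (cycle_sign \<Gamma> vs) =
    (\<Prod>i<m. switched_adj s \<Gamma> (vs ! i) (vs ! Suc i)) * switched_adj s \<Gamma> (vs ! m) (vs ! 0)"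
proof -
  have ss: "s v * s v = 1" for v using s[of v] by auto
  let ?next = "\<lambda>i. Suc i mod Suc m"
  have "(\<Prod>i<Suc m. switched_adj s \<Gamma> (vs ! i) (vs ! ?next i)) =
    (\<Prod>i<Suc m. s (vs ! i)) * (\<Prod>i<Suc m. s (vs ! ?next i)) *
    (\<Prod>i<Suc m. real_of_int (esign \<Gamma> (cyc_edge vs i)))"
    unfolding prod.distrib[symmetric] using edges vs
    by (intro prod.cong) (auto simp: switched_adj_def adj_matrix_def cyc_edge_def)
  moreover have "(\<Prod>i<Suc m. s (vs ! ?next i)) = (\<Prod>i<Suc m. s (vs ! i))"
  proof -
    have "(\<Prod>i<Suc m. s (vs ! ?next i)) = (\<Prod>i<m. s (vs ! Suc i)) * s (vs ! 0)"
      by (simp add: mod_less)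
    then show ?thesis by (simp add: prod.lessThan_Suc_shift mult.commute del: prod.lessThan_Suc)
  qed
  moreover have "(\<Prod>i<Suc m. s (vs ! i)) * (\<Prod>i<Suc m. s (vs ! i)) = 1"
    unfolding prod.distrib[symmetric] ss by simp
  moreover have "(\<Prod>i<Suc m. switched_adj s \<Gamma> (vs ! i) (vs ! ?next i)) =
    (\<Prod>i<m. switched_adj s \<Gamma> (vs ! i) (vs ! Suc i)) * switched_adj s \<Gamma> (vs ! m) (vs ! 0)"
    by simp
  ultimately show ?thesis using vs by (simp add: cycle_sign_def)
qed

lemma contains_negative_cycleI:
  assumes \<Gamma>: "signed_graph \<Gamma>" and s: "\<And>v. s v \<in> {-1, 1}"
    and vs: "length vs \<ge> 3" "distinct vs" "successively (\<lambda>v w. switched_adj s \<Gamma> v w = 1) vs"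
    and neg: "switched_adj s \<Gamma> (last vs) (hd vs) = -1"
  shows "contains_negative_cycle \<Gamma> (length vs)"
proof -
  obtain m where m: "length vs = Suc m" using vs(1) by (metis Suc_le_D numeral_3_eq_3)
  moreover from this have "vs \<noteq> []" by auto
  ultimately have ends: "last vs = vs ! m" "hd vs = vs ! 0"
    by (simp_all add: last_conv_nth hd_conv_nth)
  have pos: "switched_adj s \<Gamma> (vs ! i) (vs ! Suc i) = 1" if "i < m" for i
    using vs(3) that m by (simp add: successively_conv_nth)
  have edges: "cyc_edge vs i \<in> edges \<Gamma>" if "i < Suc m" for i
  proof (cases "i = m")
    case True
    then show ?thesis
      using switched_adj_props(4)[where s = s and v = "vs ! m" and w = "vs ! 0", OF \<Gamma> s] neg m
      by (simp add: ends cyc_edge_def)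
  next
    case False
    then show ?thesis
      using switched_adj_props(4)[where s = s and v = "vs ! i" and w = "vs ! Suc i", OF \<Gamma> s] pos[of i] m that
      by (simp add: cyc_edge_def)
  qed
  have "real_of_int (cycle_sign \<Gamma> vs) = -1"
    using cycle_sign_switched_adj[where s = s, OF s m edges] pos neg by (simp add: ends)
  then have "cycle_sign \<Gamma> vs = -1" by linarith
  then show ?thesis
    unfolding contains_negative_cycle_def is_cycle_def
    using vs edges m by (intro exI[of _ vs]) simp
qed

lemma unbalanced_imp_negative_switched_adj:
  assumes \<Gamma>: "signed_graph \<Gamma>" and s: "\<And>v. s v \<in> {-1, 1}" and unb: "\<not> balanced \<Gamma>"
  shows "\<exists>p q. switched_adj s \<Gamma> p q = -1"
proof (rule ccontr)
  assume nex: "\<nexists>p q. switched_adj s \<Gamma> p q = -1"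
  have "cycle_sign \<Gamma> vs = 1" if "is_cycle \<Gamma> vs" for vs
  proof -
    have "3 \<le> length vs" using that by (simp add: is_cycle_def)
    then obtain m where m: "length vs = Suc m" by (metis Suc_le_D numeral_3_eq_3)
    have edges: "cyc_edge vs i \<in> edges \<Gamma>" if "i < Suc m" for i
      using \<open>is_cycle \<Gamma> vs\<close> m that by (simp add: is_cycle_def)
    have one: "switched_adj s \<Gamma> v w = 1" if "{v, w} \<in> edges \<Gamma>" for v w
      using switched_adj_props(3,4)[where s = s and v = v and w = w, OF \<Gamma> s] that nex by auto
    have "switched_adj s \<Gamma> (vs ! i) (vs ! Suc i) = 1" if "i < m" for i
      using edges[of i] that m by (intro one) (simp add: cyc_edge_def)
    moreover have "switched_adj s \<Gamma> (vs ! m) (vs ! 0) = 1"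
      using edges[of m] m by (intro one) (simp add: cyc_edge_def)
    ultimately have "real_of_int (cycle_sign \<Gamma> vs) = 1"
      using cycle_sign_switched_adj[where s = s, OF s m edges] by simp
    then show ?thesis by linarith
  qed
  with unb show False by (simp add: balanced_def)
qed

lemma switching_equivalentI:
  assumes \<Gamma>: "signed_graph \<Gamma>" and \<Delta>: "signed_graph \<Delta>" and s: "\<And>v. s v \<in> {-1, 1}"
    and f: "bij f" and eq: "\<And>v w. adj_matrix \<Delta> $ f v $ f w = switched_adj s \<Gamma> v w"
  shows "switching_equivalent \<Gamma> \<Delta>"
proof -
  define U where "U = {v. s v = -1}"
  have edge_iff: "{f v, f w} \<in> edges \<Delta> \<longleftrightarrow> {v, w} \<in> edges \<Gamma>" for v w
    using switched_adj_props(4)[where s = s and v = v and w = w, OF \<Gamma> s] adj_matrix_eq_0_iff[OF \<Delta>] eq by metis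
  have "edges \<Delta> = (\<lambda>e. f ` e) ` edges \<Gamma>"
  proof (intro set_eqI iffI)
    fix e assume e: "e \<in> edges \<Delta>"
    then have "card e = 2" using \<Delta> by (simp add: signed_graph_def)
    then obtain v' w' where "e = {v', w'}" by (auto simp: card_2_iff)
    moreover obtain v w where "v' = f v" "w' = f w" using f by (meson bij_pointE)
    ultimately show "e \<in> (\<lambda>e. f ` e) ` edges \<Gamma>"
      using e edge_iff[of v w] by (intro image_eqI[of _ _ "{v, w}"]) auto
  next
    fix e' assume "e' \<in> (\<lambda>e. f ` e) ` edges \<Gamma>"
    then obtain e where e: "e \<in> edges \<Gamma>" "e' = f ` e" by auto
    then have "card e = 2" using \<Gamma> by (simp add: signed_graph_def)
    then obtain v w where "e = {v, w}" by (auto simp: card_2_iff)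
    then show "e' \<in> edges \<Delta>" using e edge_iff[of v w] by simp
  qed
  moreover have "esign \<Delta> (f ` e) = esign (switching U \<Gamma>) e" if e: "e \<in> edges \<Gamma>" for e
  proof -
    have "card e = 2" using \<Gamma> e by (simp add: signed_graph_def)
    then obtain v w where vw: "e = {v, w}" "v \<noteq> w" by (auto simp: card_2_iff)
    have "real_of_int (esign \<Delta> (f ` e)) = s v * s w * esign \<Gamma> e"
      using eq[of v w] edge_iff[of v w] e vw by (simp add: switched_adj_def adj_matrix_def)
    \<comment> \<open>The intersection has exactly one element precisely when
      \<open>s v * s w = -1\<close>.\<close>
    moreover have "{v, w} \<inter> U = (if s v = -1 then {v} else {}) \<union> (if s w = -1 then {w} else {})"
      by (auto simp: U_def)
    ultimately have "real_of_int (esign \<Delta> (f ` e)) = real_of_int (esign (switching U \<Gamma>) e)"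
      using s[of v] s[of w] vw by (auto simp: switching_def)
    then show ?thesis by linarith
  qed
  ultimately have "sgraph_iso f (switching U \<Gamma>) \<Delta>"
    using f by (simp add: sgraph_iso_def switching_def)
  then show ?thesis by (auto simp: switching_equivalent_def)
qed

section \<open>Relabelling the comparison graph and comparing matrices\<close>

lemma signed_graph_C3neg_bullet_K:
  "distinct [u, a, b] \<Longrightarrow> signed_graph (C3neg_bullet_K u a b)"
  by (auto simp: signed_graph_def C3neg_bullet_K_def)

text \<open>Three transpositions place \<open>h\<close>, \<open>p\<close>, \<open>q\<close> in turn,
  each fixing the targets already reached.\<close>

lemma bij_mapping_triple:
  fixes h p q u a b :: 'v
  assumes "distinct [h, p, q]" "distinct [u, a, b]"
  obtains f where "bij f" "f h = u" "f p = a" "f q = b"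
proof -
  define f1 where "f1 = Transposition.transpose h u"
  define f2 where "f2 = Transposition.transpose (f1 p) a"
  define f3 where "f3 = Transposition.transpose (f2 (f1 q)) b"
  have bij: "bij f1" "bij f2" "bij f3" by (simp_all add: f1_def f2_def f3_def)
  then have inj: "f1 v = f1 w \<longleftrightarrow> v = w" "f2 v = f2 w \<longleftrightarrow> v = w" for v w
    by (simp_all add: bij_is_inj inj_eq)
  have h: "f1 h = u" by (simp add: f1_def)
  then have "f1 p \<noteq> u" "f1 q \<noteq> u" using inj assms by auto
  then have hp: "f2 u = u" "f2 (f1 p) = a"
    using assms by (simp_all add: f2_def Transposition.transpose_def)
  then have "f2 (f1 q) \<noteq> u" "f2 (f1 q) \<noteq> a"
    using inj assms h by (metis distinct_length_2_or_more)+
  then have "f3 u = u" "f3 a = a" "f3 (f2 (f1 q)) = b"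
    using assms by (simp_all add: f3_def Transposition.transpose_def)
  then show thesis
    using bij h hp by (intro that[of "f3 \<circ> f2 \<circ> f1"]) (auto intro: bij_comp)
qed

lemma adj_C3neg_bullet_K_image:
  assumes "inj f" "distinct [h, p, q]"
  shows "adj_matrix (C3neg_bullet_K (f h) (f p) (f q)) $ f v $ f w =
    adj_matrix (C3neg_bullet_K h p q) $ v $ w"
proof -
  have "distinct [f h, f p, f q]" using assms by (auto simp: inj_eq)
  moreover have "{f v, f w} = {f c, f d} \<longleftrightarrow> {v, w} = {c, d}" for c d
    using assms(1) by (auto simp: doubleton_eq_iff inj_eq)
  moreover have "{f v, f w} \<inter> {f p, f q} = {} \<longleftrightarrow> {v, w} \<inter> {p, q} = {}"
    using assms(1) by (auto simp: inj_eq)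
  ultimately show ?thesis
    using assms by (simp only: adj_C3neg_bullet_K inj_eq)
qed

text \<open>Pairing both eigenvalue equations with \<open>y\<close> leaves a sum of nonnegative terms
  \<open>y v * (b v w - a v w) * x w\<close> with nonpositive value.\<close>

lemma dominated_matrix_eq:
  fixes a b :: "'v::finite \<Rightarrow> 'v \<Rightarrow> real"
  assumes le: "\<And>v w. a v w \<le> b v w" and sym: "\<And>v w. b v w = b w v"
    and x: "\<And>v. 0 \<le> x v" "\<And>v. (\<Sum>w\<in>UNIV. a v w * x w) = lam * x v"
    and y: "\<And>v. 0 < y v" "\<And>v. (\<Sum>w\<in>UNIV. b v w * y w) = \<rho> * y v"
    and "\<rho> \<le> lam" "0 < x w"
  shows "a v w = b v w"
proof -
  let ?t = "\<lambda>v w. y v * (b v w - a v w) * x w"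
  have "(\<Sum>v\<in>UNIV. \<Sum>w\<in>UNIV. ?t v w) =
    (\<Sum>v\<in>UNIV. \<Sum>w\<in>UNIV. y v * b v w * x w) - (\<Sum>v\<in>UNIV. y v * (\<Sum>w\<in>UNIV. a v w * x w))"
    by (simp add: algebra_simps sum_subtractf sum_distrib_left)
  also have "(\<Sum>v\<in>UNIV. \<Sum>w\<in>UNIV. y v * b v w * x w) = (\<Sum>w\<in>UNIV. x w * (\<Sum>v\<in>UNIV. b w v * y v))"
    by (subst sum.swap) (simp add: sum_distrib_left sym mult_ac)
  also have "\<dots> - (\<Sum>v\<in>UNIV. y v * (\<Sum>w\<in>UNIV. a v w * x w)) = (\<rho> - lam) * (\<Sum>v\<in>UNIV. x v * y v)"
    unfolding x(2) y(2) by (simp add: algebra_simps sum_subtractf sum_distrib_left)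
  also have "\<dots> \<le> 0"
    using \<open>\<rho> \<le> lam\<close> x(1) y(1) by (intro mult_nonpos_nonneg sum_nonneg mult_nonneg_nonneg) (auto intro: less_imp_le)
  finally have le0: "(\<Sum>v\<in>UNIV. \<Sum>w\<in>UNIV. ?t v w) \<le> 0" .
  have nonneg: "0 \<le> ?t v w" for v w
    using le[of v w] x(1) y(1)[of v] by (simp add: less_imp_le)
  have "(\<Sum>v\<in>UNIV. \<Sum>w\<in>UNIV. ?t v w) = 0"
    using le0 nonneg by (intro antisym sum_nonneg) auto
  then have "(\<Sum>w\<in>UNIV. ?t v w) = 0"
    using nonneg by (subst (asm) sum_nonneg_eq_0_iff) (auto intro: sum_nonneg)
  then have "?t v w = 0"
    using nonneg by (subst (asm) sum_nonneg_eq_0_iff) auto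
  then show ?thesis using y(1)[of v] \<open>0 < x w\<close> by auto
qed

theorem theorem1p4:
  fixes \<Gamma> \<Gamma>\<^sub>1 :: "'v::finite sgraph" and u a b :: 'v and n r :: nat
  assumes "n > 0" and "CARD('v) = n"
    and "signed_graph \<Gamma>" and "\<not> balanced \<Gamma>"
    and "4 \<le> r" and "r \<le> n div 3 + 1"
    and "distinct [u, a, b]" and "\<Gamma>\<^sub>1 = C3neg_bullet_K u a b"
    and "index \<Gamma> \<ge> index \<Gamma>\<^sub>1"
    and "\<not> switching_equivalent \<Gamma> \<Gamma>\<^sub>1"
  shows "contains_negative_cycle \<Gamma> r"
proof -
  \<comment> \<open>The bounds on \<open>r\<close> give \<open>n div 3 \<ge> 3\<close>, hence
    \<open>n \<ge> 9\<close>.\<close>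
  have n: "3 * (r - 1) \<le> CARD('v)" "9 \<le> CARD('v)" using assms(2,5,6) by auto
  obtain \<rho> where \<rho>: "real CARD('v) - 3 < \<rho>"
    "\<rho> * (\<rho> - real CARD('v) + 4) * (\<rho> + 1) =
      (real CARD('v) - 3) * (\<rho> + 1) + 2 * (\<rho> - real CARD('v) + 4)"
    using C3neg_bullet_K_root_exists[of "real CARD('v)"] n by auto
  \<comment> \<open>Used for two triples: \<open>u\<close>, \<open>a\<close>, \<open>b\<close> show
    that \<rho> is an eigenvalue of the given graph, and \<open>h\<close>, \<open>p\<close>,
    \<open>q\<close> serve the final comparison.\<close>
  define y where "y c d e v = (if v = c then (\<rho> - real CARD('v) + 4) * (\<rho> + 1)
    else if v = d \<or> v = e then \<rho> - real CARD('v) + 4 else \<rho> + 1)" for c d e v :: 'v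
  have y_pos: "0 < y c d e v" for c d e v using \<rho>(1) n by (simp add: y_def)
  have y_eigen: "(\<Sum>w\<in>UNIV. adj_matrix (C3neg_bullet_K c d e) $ v $ w * y c d e w) = \<rho> * y c d e v"
    if "distinct [c, d, e]" for c d e v
    using C3neg_bullet_K_eigenvector[OF that \<rho>(2)] by (simp add: y_def)
  define lam where "lam = index \<Gamma>"
  have "\<rho> \<in> eigenvalues (adj_matrix \<Gamma>\<^sub>1)"
  proof -
    let ?Y = "\<chi> v. y u a b v"
    have "?Y $ u \<noteq> 0" using y_pos[of u a b u] by simp
    then have "?Y \<noteq> 0" by (metis zero_index)
    moreover have "adj_matrix \<Gamma>\<^sub>1 *v ?Y = \<rho> *\<^sub>R ?Y"
      using y_eigen assms(7,8) by (simp add: vec_eq_iff matrix_vector_mult_def)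
    ultimately show ?thesis by (auto simp: eigenvalues_def)
  qed
  then have "\<rho> \<le> lam" using eigenvalue_le_index assms(9) unfolding lam_def by fastforce
  obtain X where X: "X \<noteq> 0" "adj_matrix \<Gamma> *v X = lam *\<^sub>R X"
    using index_in_eigenvalues[of \<Gamma>] by (auto simp: eigenvalues_def lam_def)
  \<comment> \<open>Switching by the signs of \<open>X\<close> turns the eigenvector into its
    absolute values.\<close>
  define s :: "'v \<Rightarrow> real" where "s v = (if X $ v < 0 then -1 else 1)" for v
  define M where "M = Max (range (\<lambda>v. \<bar>X $ v\<bar>))"
  define x where "x v = \<bar>X $ v\<bar> / M" for v
  have s: "s v \<in> {-1, 1}" for v by (simp add: s_def)
  have "M \<in> range (\<lambda>v. \<bar>X $ v\<bar>)" unfolding M_def by (intro Max_in) auto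
  then obtain h where h: "\<bar>X $ h\<bar> = M" by auto
  have M: "\<bar>X $ v\<bar> \<le> M" for v unfolding M_def by (intro Max_ge) auto
  have "M > 0"
  proof -
    obtain v where "X $ v \<noteq> 0" using X(1) by (auto simp: vec_eq_iff)
    then show ?thesis using M[of v] by linarith
  qed
  have sX: "s v * \<bar>X $ v\<bar> = X $ v" "s v * X $ v = \<bar>X $ v\<bar>" for v by (auto simp: s_def)
  have eigen: "lam * x v = (\<Sum>w\<in>UNIV. switched_adj s \<Gamma> v w * x w)" for v
  proof -
    have "(\<Sum>w\<in>UNIV. switched_adj s \<Gamma> v w * x w) =
      (\<Sum>w\<in>UNIV. s v * (adj_matrix \<Gamma> $ v $ w * (s w * \<bar>X $ w\<bar>)) / M)"
      by (intro sum.cong) (auto simp: switched_adj_def x_def)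
    also have "\<dots> = s v * (adj_matrix \<Gamma> *v X) $ v / M"
      by (simp add: sX matrix_vector_mult_def sum_distrib_left sum_divide_distrib)
    also have "\<dots> = lam * (s v * X $ v) / M" by (simp add: X)
    finally show ?thesis by (simp add: sX x_def)
  qed
  interpret nonneg_eigenvector "switched_adj s \<Gamma>" x lam h
  proof
    show "switched_adj s \<Gamma> v w = switched_adj s \<Gamma> w v" "switched_adj s \<Gamma> v v = 0"
      "switched_adj s \<Gamma> v w \<in> {-1, 0, 1}" for v w
      by (rule switched_adj_props[where s = s, OF assms(3) s])+
    show "0 \<le> x v" "x v \<le> 1" "x h = 1" for v
      using M[of v] \<open>M > 0\<close> h by (simp_all add: x_def)
    show "lam * x v = (\<Sum>w\<in>UNIV. switched_adj s \<Gamma> v w * x w)" for v by (rule eigen)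
    show "real CARD('v) - 3 < lam" using \<rho>(1) \<open>\<rho> \<le> lam\<close> by linarith
    show "3 \<le> CARD('v)" using n by simp
  qed
  obtain p q where pq: "switched_adj s \<Gamma> p q = -1"
    using unbalanced_imp_negative_switched_adj[where s = s, OF assms(3) s assms(4)] by blast
  from pq assms(5) n(1) show ?thesis
  proof (cases rule: long_path_or_exceptional)
    case (path vs)
    have "successively (\<lambda>v w. switched_adj s \<Gamma> v w = 1) vs" "distinct vs"
      using path(1) by (simp_all add: pos_path_def pos_def[abs_def])
    then show ?thesis
      using contains_negative_cycleI[where s = s and vs = vs, OF assms(3) s] path pq assms(5) sym[of p q] by simp
  next
    case exceptional
    have "p \<noteq> q" using pq irrefl by auto
    with exceptional have dist: "distinct [h, p, q]" by auto
    let ?B = "adj_matrix (C3neg_bullet_K h p q)"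
    have nonpos: "switched_adj s \<Gamma> v w \<le> 0" if "v \<in> {p, q}" "w \<noteq> h" for v w
      using exceptional(3,4) that by (intro not_pos_le_0) (auto simp: nbrs_def)
    have le_1: "switched_adj s \<Gamma> v w \<le> 1" for v w using entries[of v w] by auto
    have le: "switched_adj s \<Gamma> v w \<le> ?B $ v $ w" for v w
    proof -
      \<comment> \<open>The last case consists of the pairs joining \<open>p\<close> or
        \<open>q\<close> to a vertex outside \<open>{h, p, q}\<close>: there \<open>?B\<close> is 0
        and the switched entry is nonpositive.\<close>
      consider "v = w" | "{v, w} = {p, q}" | "v \<noteq> w" "{v, w} \<inter> {p, q} = {}"
        | "{v, w} = {h, p}" | "{v, w} = {h, q}"
        | "v \<noteq> w" "{v, w} \<noteq> {p, q}" "{v, w} \<inter> {p, q} \<noteq> {}" "{v, w} \<noteq> {h, p}" "{v, w} \<noteq> {h, q}"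
        by blast
      then show ?thesis
      proof cases
        case 6
        then have "switched_adj s \<Gamma> v w \<le> 0"
          using nonpos[of v w] nonpos[of w v] sym[of v w] by (auto simp: doubleton_eq_iff)
        with 6 show ?thesis unfolding adj_C3neg_bullet_K[OF dist] by simp
      qed (use dist pq sym[of p q] irrefl le_1 in \<open>auto simp: adj_C3neg_bullet_K[OF dist] doubleton_eq_iff\<close>)
    qed
    have B_sym: "?B $ v $ w = ?B $ w $ v" for v w
      using transpose_adj_matrix[of "C3neg_bullet_K h p q"] by (metis (lifting) transpose_def vec_lambda_beta)
    have eq: "switched_adj s \<Gamma> v w = ?B $ v $ w" if "0 < x w" for v w
      by (rule dominated_matrix_eq[where x = x and lam = lam and y = "y h p q" and \<rho> = \<rho>])
        (use le B_sym nonneg eigen y_pos y_eigen[OF dist] \<open>\<rho> \<le> lam\<close> that in auto)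
    \<comment> \<open>The weights of \<open>p\<close> and \<open>q\<close> may vanish. Symmetry
      settles every entry with an index outside \<open>{p, q}\<close>; the others are 0 on the
      diagonal and -1 off it in both matrices.\<close>
    have "switched_adj s \<Gamma> v w = ?B $ v $ w" for v w
    proof (cases "v \<in> {p, q} \<and> w \<in> {p, q}")
      case True
      then show ?thesis
        using pq sym[of p q] irrefl \<open>p \<noteq> q\<close> by (auto simp: adj_C3neg_bullet_K[OF dist] doubleton_eq_iff)
    next
      case False
      then have "0 < x v \<or> 0 < x w" using exceptional(5) by auto
      then show ?thesis using eq sym B_sym by metis
    qed
    moreover obtain f where f: "bij f" "f h = u" "f p = a" "f q = b"
      using bij_mapping_triple[OF dist assms(7)] .
    ultimately have "adj_matrix \<Gamma>\<^sub>1 $ f v $ f w = switched_adj s \<Gamma> v w" for v w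
      using adj_C3neg_bullet_K_image[OF bij_is_inj[OF f(1)] dist] assms(8) by simp
    then have "switching_equivalent \<Gamma> \<Gamma>\<^sub>1"
      using switching_equivalentI[where s = s, OF assms(3) _ s f(1)] signed_graph_C3neg_bullet_K[OF assms(7)] assms(8)
      by blast
    with assms(10) show ?thesis by contradiction
  qed
qed

end
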